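(* Let $t\ge 1$ and let $A_1,\ldots,A_t$ be real matrices, each with $n$ columns. Let $D:=\max_{i=1,2,\ldots,t}\operatorname{detlb}(A_i)$, and let $A$ be a matrix with $n$ columns in which each row is a row of some of the matrices $A_i$. Then $$\operatorname{detlb}(A)\le D\sqrt{e\,t},$$ where $e$ is the base of the natural logarithm.
   Context: For a real matrix $A$, $\operatorname{detlb}(A)=\max_{k}\max_{B}|\det B|^{1/k}$, where $k\ge 1$ and $B$ ranges over all $k\times k$ submatrices of $A$ (arbitrary choices of $k$ rows and $k$ columns of $A$). *)

theory Defs
  imports Complex_Main "Jordan_Normal_Form.DL_Submatrix" "Jordan_Normal_Form.Determinant"
begin

text \<open>
  \<open>submatrix A I J\<close> lists the chosen rows and columns in increasing order; another order only
  changes the sign of the determinant.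
\<close>

definition detlb_values :: "real mat \<Rightarrow> real set" where
  "detlb_values A =
     {root k \<bar>det (submatrix A I J)\<bar> | k I J.
        1 \<le> k \<and> I \<subseteq> {..<dim_row A} \<and> J \<subseteq> {..<dim_col A} \<and> card I = k \<and> card J = k}"

text \<open>A matrix without rows or without columns has no \<open>k \<times> k\<close> submatrix with \<open>k \<ge> 1\<close>; the maximum
  of the empty family of nonnegative numbers is taken to be 0.\<close>

definition detlb :: "real mat \<Rightarrow> real" where
  "detlb A = (if dim_row A = 0 \<or> dim_col A = 0 then 0 else Max (detlb_values A))"

lemma finite_detlb_values: "finite (detlb_values A)"
proof -
  have "detlb_values A \<subseteq>
      (\<lambda>(I, J). root (card I) \<bar>det (submatrix A I J)\<bar>) ` (Pow {..<dim_row A} \<times> Pow {..<dim_col A})"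
    unfolding detlb_values_def by force
  then show ?thesis
    by (rule finite_subset) simp
qed

lemma detlb_values_nonempty:
  assumes "dim_row A \<noteq> 0" "dim_col A \<noteq> 0"
  shows "detlb_values A \<noteq> {}"
proof -
  have "root 1 \<bar>det (submatrix A {0} {0})\<bar> \<in> detlb_values A"
    unfolding detlb_values_def using assms
    by (intro CollectI exI[of _ 1] exI[of _ "{0}"]) auto
  then show ?thesis by blast
qed

end

theory Submission
  imports Defs
begin

text \<open>
  Group the rows of a \<open>k \<times> k\<close> submatrix \<open>B\<close> of \<open>A\<close> by the matrix \<open>A\<^sub>a\<close> they come from, with \<open>m\<^sub>a\<close>
  rows in the group \<open>B\<^sub>a\<close>. Fischer's inequality bounds \<open>(det B)\<^sup>2\<close> by the product of the Gram
  determinants of the \<open>B\<^sub>a\<close>. By Cauchy--Binet each of these is at most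
  \<open>k ^ m\<^sub>a / m\<^sub>a! * D ^ (2 * m\<^sub>a)\<close>, and \<open>x ^ m / m! \<le> exp x\<close> at \<open>x = k / t\<close> bounds the product of the
  factors \<open>k ^ m\<^sub>a / m\<^sub>a!\<close> by \<open>(e * t) ^ k\<close>.
\<close>

section \<open>Orthogonal projection in R^k and distances to spans\<close>

definition ip :: "nat \<Rightarrow> (nat \<Rightarrow> real) \<Rightarrow> (nat \<Rightarrow> real) \<Rightarrow> real" where
  "ip k x y = (\<Sum>j<k. x j * y j)"

lemma ip_commute: "ip k x y = ip k y x"
  by (simp add: ip_def mult.commute)

lemma ip_self_nonneg: "0 \<le> ip k x x"
  by (simp add: ip_def sum_nonneg)

text \<open>Vectors of R^k are functions of which only the entries below \<open>k\<close> count, so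
  \<open>x\<close> itself need not be the zero function here. Being orthogonal to everything is all
  that the degenerate case of Gram--Schmidt requires.\<close>

lemma ip_self_zero: "ip k x x = 0 \<Longrightarrow> ip k x y = 0"
  by (simp add: ip_def sum_nonneg_eq_0_iff)

lemma ip_add_left: "ip k (\<lambda>j. x j + y j) z = ip k x z + ip k y z"
  by (simp add: ip_def algebra_simps sum.distrib)

lemma ip_diff_left: "ip k (\<lambda>j. x j - y j) z = ip k x z - ip k y z"
  by (simp add: ip_def algebra_simps sum_subtractf)

lemma ip_scale_left: "ip k (\<lambda>j. a * x j) z = a * ip k x z"
  by (simp add: ip_def sum_distrib_left mult.assoc)

lemma ip_sum_left: "ip k (\<lambda>j. \<Sum>x\<in>X. g x j) z = (\<Sum>x\<in>X. ip k (g x) z)"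
  unfolding ip_def sum_distrib_right by (rule sum.swap)

text \<open>Gram--Schmidt by induction, for vectors that may be linearly dependent. The new vector
  \<open>v z\<close> is first reduced modulo the old ones to \<open>p\<close>, the vector
  \<open>u\<close> to \<open>q\<close>, and then the component of \<open>q\<close> along
  \<open>p\<close> is removed.\<close>

lemma exists_orthogonal_residual:
  assumes "finite Y"
  shows "\<exists>c. \<forall>y\<in>Y. ip k (\<lambda>j. u j - (\<Sum>x\<in>Y. c x * v x j)) (v y) = 0"
  using assms
proof (induction Y arbitrary: u rule: finite_induct)
  case empty
  then show ?case by simp
next
  case (insert z Y)
  obtain a where a: "\<forall>y\<in>Y. ip k (\<lambda>j. v z j - (\<Sum>x\<in>Y. a x * v x j)) (v y) = 0"
    using insert.IH by blast
  obtain b where b: "\<forall>y\<in>Y. ip k (\<lambda>j. u j - (\<Sum>x\<in>Y. b x * v x j)) (v y) = 0"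
    using insert.IH by blast
  define p where "p = (\<lambda>j. v z j - (\<Sum>x\<in>Y. a x * v x j))"
  define q where "q = (\<lambda>j. u j - (\<Sum>x\<in>Y. b x * v x j))"
  \<comment> \<open>If \<open>ip k p p = 0\<close>, the quotient is 0 by convention; this does no
    harm, since then \<open>ip k q p = 0\<close> as well.\<close>
  define s where "s = ip k q p / ip k p p"
  define c where "c = (\<lambda>x. if x = z then s else b x - s * a x)"
  have p0: "ip k p (v y) = 0" and q0: "ip k q (v y) = 0" if "y \<in> Y" for y
    using that a b by (auto simp: p_def q_def)
  have "(\<Sum>x\<in>Y. c x * v x j) = (\<Sum>x\<in>Y. (b x - s * a x) * v x j)" for j
    using insert.hyps by (intro sum.cong) (auto simp: c_def)
  then have sum_insert: "(\<Sum>x\<in>insert z Y. c x * v x j) =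
      s * v z j + ((\<Sum>x\<in>Y. b x * v x j) - s * (\<Sum>x\<in>Y. a x * v x j))" for j
    using insert.hyps
    by (simp add: c_def[THEN fun_cong, of z] left_diff_distrib sum_subtractf sum_distrib_left mult.assoc)
  have c: "(\<lambda>j. u j - (\<Sum>x\<in>insert z Y. c x * v x j)) = (\<lambda>j. q j - s * p j)"
    unfolding p_def q_def right_diff_distrib sum_insert by (intro ext) linarith
  have vz: "v z = (\<lambda>j. p j + (\<Sum>x\<in>Y. a x * v x j))"
    by (simp add: p_def)
  \<comment> \<open>Modulo the span of the old vectors, \<open>v z\<close> and \<open>p\<close>
    agree, so orthogonality to \<open>v z\<close> can be tested on \<open>p\<close>.\<close>
  have orth: "ip k r (v z) = ip k r p" if "\<forall>y\<in>Y. ip k r (v y) = 0" for r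
    using that by (subst (1 2) ip_commute, subst vz)
      (simp add: ip_add_left ip_sum_left ip_scale_left ip_commute[of k "v _" r])
  have Y: "\<forall>y\<in>Y. ip k (\<lambda>j. q j - s * p j) (v y) = 0"
    using p0 q0 by (simp add: ip_diff_left ip_scale_left)
  have "ip k q p = 0" if "ip k p p = 0"
    using ip_self_zero[OF that, of q] by (simp add: ip_commute)
  then have "ip k (\<lambda>j. q j - s * p j) p = 0"
    by (simp only: ip_diff_left ip_scale_left) (auto simp: s_def)
  with orth[OF Y] Y show ?case
    by (intro exI[of _ c]) (simp add: c)
qed

text \<open>A choice is made because dependent vectors admit several coefficient families.\<close>

definition proj_coeff :: "nat \<Rightarrow> (nat \<Rightarrow> nat \<Rightarrow> real) \<Rightarrow> nat set \<Rightarrow> (nat \<Rightarrow> real) \<Rightarrow> nat \<Rightarrow> real" where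
  "proj_coeff k v Y u = (SOME c. \<forall>y\<in>Y. ip k (\<lambda>j. u j - (\<Sum>x\<in>Y. c x * v x j)) (v y) = 0)"

definition residual :: "nat \<Rightarrow> (nat \<Rightarrow> nat \<Rightarrow> real) \<Rightarrow> nat set \<Rightarrow> (nat \<Rightarrow> real) \<Rightarrow> nat \<Rightarrow> real" where
  "residual k v Y u = (\<lambda>j. u j - (\<Sum>x\<in>Y. proj_coeff k v Y u x * v x j))"

text \<open>For finite \<open>Y\<close> this is the squared Euclidean distance in R^k from
  \<open>u\<close> to the span of the \<open>v y\<close> with \<open>y\<close> in \<open>Y\<close>,
  by \<open>residual_orthogonal\<close>.\<close>

definition sqdist :: "nat \<Rightarrow> (nat \<Rightarrow> nat \<Rightarrow> real) \<Rightarrow> nat set \<Rightarrow> (nat \<Rightarrow> real) \<Rightarrow> real" where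
  "sqdist k v Y u = ip k (residual k v Y u) (residual k v Y u)"

lemma residual_orthogonal:
  assumes "finite Y" "y \<in> Y"
  shows "ip k (residual k v Y u) (v y) = 0"
  using someI_ex[OF exists_orthogonal_residual[OF assms(1), of k u v]] assms(2)
  unfolding residual_def proj_coeff_def by blast

lemma sqdist_nonneg: "0 \<le> sqdist k v Y u"
  by (simp add: sqdist_def ip_self_nonneg)

text \<open>Pythagoras: the two residuals differ by a vector \<open>q\<close> in the span for
  \<open>Y\<close>, which is orthogonal to the residual for \<open>Y\<close>, so the distance for
  \<open>Z\<close> exceeds the other by \<open>ip k q q\<close>.\<close>

lemma sqdist_antimono:
  assumes "finite Y" "Z \<subseteq> Y"
  shows "sqdist k v Y u \<le> sqdist k v Z u"
proof -
  define w where "w = residual k v Y u"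
  define a where "a = proj_coeff k v Y u"
  define b where "b = (\<lambda>x. if x \<in> Z then proj_coeff k v Z u x else 0)"
  define q where "q = (\<lambda>j. \<Sum>x\<in>Y. (a x - b x) * v x j)"
  have "(\<Sum>x\<in>Y. b x * v x j) = (\<Sum>x\<in>Z. proj_coeff k v Z u x * v x j)" for j
    using assms by (intro sum.mono_neutral_cong_right) (auto simp: b_def)
  then have Z: "residual k v Z u = (\<lambda>j. w j + q j)"
    by (simp add: residual_def w_def q_def a_def[symmetric] algebra_simps sum_subtractf)
  have "ip k q w = 0"
    unfolding q_def ip_sum_left ip_scale_left w_def
    using residual_orthogonal[OF assms(1)] by (simp add: ip_commute[of k "v _"])
  then have "sqdist k v Z u = ip k w w + ip k q q"
    unfolding sqdist_def Z ip_add_left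
    by (simp add: ip_commute[of k _ "\<lambda>j. w j + q j"] ip_add_left ip_commute[of k w q])
  then show ?thesis
    using ip_self_nonneg[of k q] by (simp add: sqdist_def w_def)
qed

section \<open>Gram determinants as products of squared distances\<close>

definition gram :: "nat \<Rightarrow> nat \<Rightarrow> (nat \<Rightarrow> nat \<Rightarrow> real) \<Rightarrow> real mat" where
  "gram k m v = mat m m (\<lambda>(i, j). ip k (v i) (v j))"

lemma gram_eq_mult_transpose:
  "gram k m v = mat m k (\<lambda>(i, j). v i j) * transpose_mat (mat m k (\<lambda>(i, j). v i j))"
  by (rule eq_matI) (auto simp: gram_def ip_def scalar_prod_def atLeast0LessThan)

text \<open>Replacing each vector by its residual modulo its predecessors multiplies by a
  unitriangular matrix, which preserves the Gram determinant and makes the Gram matrix diagonal. The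
  enumeration \<open>p\<close> allows both the full list of rows and a single class.\<close>

lemma det_gram_eq_prod_sqdist:
  assumes p: "inj_on p {..<m}"
  shows "det (gram k m (\<lambda>i. v (p i))) = (\<Prod>i<m. sqdist k v (p ` {..<i}) (v (p i)))"
proof -
  define c where "c = (\<lambda>i. proj_coeff k v (p ` {..<i}) (v (p i)))"
  define w where "w = (\<lambda>i. residual k v (p ` {..<i}) (v (p i)))"
  define L where "L = mat m m (\<lambda>(i, j). if j = i then 1 else if j < i then - c i (p j) else 0)"
  define V where "V = mat m k (\<lambda>(i, j). v (p i) j)"
  define W where "W = mat m k (\<lambda>(i, j). w i j)"
  have L: "L \<in> carrier_mat m m" and V: "V \<in> carrier_mat m k"
    by (auto simp: L_def V_def)
  have w: "w i j = v (p i) j - (\<Sum>l<i. c i (p l) * v (p l) j)" if "i < m" for i j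
  proof -
    have "inj_on p {..<i}"
      using p that by (auto intro: inj_on_subset)
    then show ?thesis
      by (simp add: w_def residual_def c_def sum.reindex)
  qed
  have "(\<Sum>l<m. (if l = i then 1 else if l < i then - c i (p l) else 0) * v (p l) j) = w i j"
    if i: "i < m" for i j
  proof -
    have "(\<Sum>l<m. (if l = i then 1 else if l < i then - c i (p l) else 0) * v (p l) j)
      = (\<Sum>l\<in>insert i {..<i}. (if l = i then 1 else - c i (p l)) * v (p l) j)"
      using i by (intro sum.mono_neutral_cong_right) auto
    also have "\<dots> = v (p i) j + (\<Sum>l<i. - (c i (p l) * v (p l) j))"
      by (subst sum.insert) (auto intro!: sum.cong)
    finally show ?thesis
      by (simp add: w[OF i] sum_negf)
  qed
  then have W: "W = L * V"
    by (intro eq_matI) (auto simp: W_def L_def V_def scalar_prod_def atLeast0LessThan)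
  have "det L = 1"
    by (subst det_lower_triangular[of m])
      (auto simp: L_def prod_list_diag_prod)
  have "gram k m w = W * transpose_mat W"
    by (simp add: gram_eq_mult_transpose W_def)
  also have "\<dots> = (L * V) * (transpose_mat V * transpose_mat L)"
    unfolding W using transpose_mult[OF L V] by simp
  also have "\<dots> = L * (V * transpose_mat V) * transpose_mat L"
    using L V by (simp add: assoc_mult_mat[of _ m m _ k _ m] assoc_mult_mat[of _ m k _ m _ m]
      assoc_mult_mat[of _ m m _ m _ m] assoc_mult_mat[of _ m k _ k _ m])
  also have "V * transpose_mat V = gram k m (\<lambda>i. v (p i))"
    by (simp add: gram_eq_mult_transpose V_def)
  finally have "gram k m w = L * gram k m (\<lambda>i. v (p i)) * transpose_mat L" .
  then have "det (gram k m w) = det (L * gram k m (\<lambda>i. v (p i))) * det (transpose_mat L)"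
    using L by (simp add: gram_def det_mult[of _ m])
  also have "\<dots> = det (gram k m (\<lambda>i. v (p i)))"
    using L \<open>det L = 1\<close> det_mult[OF L, of "gram k m (\<lambda>i. v (p i))"]
    by (simp add: gram_def det_transpose)
  finally have eq: "det (gram k m (\<lambda>i. v (p i))) = det (gram k m w)" ..
  have orth: "ip k (w i) (w j) = 0" if "i < j" "j < m" for i j
  proof -
    have 0: "ip k (v (p l)) (w j) = 0" if "l < j" for l
      unfolding ip_commute[of k "v (p l)"] w_def
      using that by (intro residual_orthogonal) auto
    have "w i = (\<lambda>x. v (p i) x - (\<Sum>l<i. c i (p l) * v (p l) x))"
      using w that by auto
    then have "ip k (w i) (w j) = ip k (v (p i)) (w j) - (\<Sum>l<i. c i (p l) * ip k (v (p l)) (w j))"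
      by (simp add: ip_diff_left ip_sum_left ip_scale_left)
    also have "\<dots> = 0"
      using 0 that by simp
    finally show ?thesis .
  qed
  have "det (gram k m w) = (\<Prod>i<m. ip k (w i) (w i))"
    by (subst det_lower_triangular[of m])
      (auto simp: gram_def orth prod_list_diag_prod atLeast0LessThan)
  then show ?thesis
    by (simp add: eq sqdist_def w_def)
qed

section \<open>Enumeration of classes and Fischer's inequality\<close>

text \<open>An element of \<open>S\<close> is recovered by \<open>pick\<close> from its rank, and
  elements below \<open>pick S i\<close> have rank below \<open>i\<close>. This describes the
  predecessors inside a class by order alone.\<close>

lemma pick_image_lessThan:
  assumes "finite S" "i < card S"
  shows "pick S ` {..<i} = {s\<in>S. s < pick S i}"
proof
  show "pick S ` {..<i} \<subseteq> {s\<in>S. s < pick S i}"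
    using assms by (auto intro: pick_in_set_le pick_mono_le)
  show "{s\<in>S. s < pick S i} \<subseteq> pick S ` {..<i}"
  proof
    fix s assume s: "s \<in> {s\<in>S. s < pick S i}"
    define l where "l = card {a\<in>S. a < s}"
    have "l < card {a\<in>S. a < pick S i}"
      unfolding l_def using s assms by (intro psubset_card_mono) auto
    then have "l < i"
      using assms by (simp add: card_pick_le)
    moreover have "pick S l = s"
      using s pick_card_in_set by (simp add: l_def)
    ultimately show "s \<in> pick S ` {..<i}" by auto
  qed
qed

lemma bij_betw_pick:
  assumes "finite S"
  shows "bij_betw (pick S) {..<card S} S"
proof -
  have inj: "inj_on (pick S) {..<card S}"
    by (intro linorder_inj_onI) (auto dest: pick_mono_le)
  moreover have "pick S ` {..<card S} = S"
    using assms inj by (intro card_subset_eq) (auto simp: card_image pick_in_set_le)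
  ultimately show ?thesis by (simp add: bij_betw_def)
qed

text \<open>Fischer's inequality: dropping the rows of other classes from the span only increases the
  distances in the product formula for the Gram determinant.\<close>

lemma det_sq_le_prod_det_gram:
  fixes v :: "nat \<Rightarrow> nat \<Rightarrow> real" and cl :: "nat \<Rightarrow> 'c"
  assumes T: "finite T" "cl ` {..<k} \<subseteq> T"
  defines "S \<equiv> \<lambda>a. {r. r < k \<and> cl r = a}"
  shows "(det (mat k k (\<lambda>(i, j). v i j)))\<^sup>2 \<le>
    (\<Prod>a\<in>T. det (gram k (card (S a)) (\<lambda>i. v (pick (S a) i))))"
proof -
  let ?M = "mat k k (\<lambda>(i, j). v i j)"
  have "(det ?M)\<^sup>2 = det (gram k k v)"
    using det_mult[of ?M k "transpose_mat ?M"] det_transpose[of ?M k]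
    by (simp add: gram_eq_mult_transpose power2_eq_square)
  also have "\<dots> = (\<Prod>i<k. sqdist k v {..<i} (v i))"
    using det_gram_eq_prod_sqdist[of id k k v] by simp
  also have "\<dots> \<le> (\<Prod>i<k. sqdist k v {s\<in>S (cl i). s < i} (v i))"
    by (intro prod_mono conjI sqdist_nonneg sqdist_antimono) auto
  also have "\<dots> = (\<Prod>a\<in>T. \<Prod>i\<in>{i. i \<in> {..<k} \<and> cl i = a}. sqdist k v {s\<in>S (cl i). s < i} (v i))"
    by (rule prod.group[OF _ T, symmetric]) simp
  also have "\<dots> = (\<Prod>a\<in>T. \<Prod>i\<in>S a. sqdist k v {s\<in>S a. s < i} (v i))"
    by (intro prod.cong) (auto simp: S_def)
  also have "\<dots> = (\<Prod>a\<in>T. det (gram k (card (S a)) (\<lambda>i. v (pick (S a) i))))"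
  proof (rule prod.cong)
    fix a
    have fin: "finite (S a)" by (simp add: S_def)
    note bij = bij_betw_pick[OF fin]
    have "(\<Prod>i\<in>S a. sqdist k v {s\<in>S a. s < i} (v i)) =
      (\<Prod>i<card (S a). sqdist k v {s\<in>S a. s < pick (S a) i} (v (pick (S a) i)))"
      by (rule prod.reindex_bij_betw[OF bij, symmetric])
    also have "\<dots> = (\<Prod>i<card (S a). sqdist k v (pick (S a) ` {..<i}) (v (pick (S a) i)))"
      using fin by (intro prod.cong) (auto simp: pick_image_lessThan)
    also have "\<dots> = det (gram k (card (S a)) (\<lambda>i. v (pick (S a) i)))"
      using bij by (simp add: det_gram_eq_prod_sqdist bij_betw_def)
    finally show "(\<Prod>i\<in>S a. sqdist k v {s\<in>S a. s < i} (v i)) =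
      det (gram k (card (S a)) (\<lambda>i. v (pick (S a) i)))" .
  qed simp
  finally show ?thesis .
qed

section \<open>Cauchy--Binet and the bound for one Gram determinant\<close>

text \<open>The Cauchy--Binet formula, summed over all column choices with repetitions and orderings.
  Compared with the usual sum over column sets every term occurs \<open>m!\<close> times, and choices with a
  repetition contribute 0.\<close>

lemma fact_mult_det_gram:
  "fact m * det (gram k m v) =
    (\<Sum>f\<in>{0..<m} \<rightarrow>\<^sub>E {..<k}. (det (mat m m (\<lambda>(i, j). v j (f i))))\<^sup>2)"
proof -
  define F where "F = ({0..<m} \<rightarrow>\<^sub>E {..<k})"
  define P where "P = {p. p permutes {0..<m}}"
  define d where "d = (\<lambda>f. det (mat m m (\<lambda>(i, j). v j (f i))))"
  have P_less: "p i < m" if "p \<in> P" "i < m" for p i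
    using that permutes_in_image[of p "{0..<m}" i] by (simp add: P_def)
  \<comment> \<open>Two Leibniz expansions: this one permutes the vectors, \<open>d_col\<close>
    permutes the chosen coordinates.\<close>
  have d_row: "d f = (\<Sum>p\<in>P. signof p * (\<Prod>i=0..<m. v (p i) (f i)))" for f
    unfolding d_def
    by (subst det_def'[of _ m]) (auto intro!: sum.cong prod.cong simp: P_less simp flip: P_def)
  have d_col: "d f = (\<Sum>p\<in>P. signof p * (\<Prod>j=0..<m. v j (f (p j))))" for f
    unfolding d_def
    by (subst det_col[of _ m])
      (auto intro!: sum.cong prod.cong simp: P_less atLeast0LessThan[symmetric] simp flip: P_def)
  have d_comp: "signof p * d f = d (f \<circ> p)" if "p \<in> P" for p f
  proof -
    have "mat m m (\<lambda>(i, j). mat m m (\<lambda>(i, j). v j (f i)) $$ (p i, j)) =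
      mat m m (\<lambda>(i, j). v j ((f \<circ> p) i))"
      using that by (intro eq_matI) (auto simp: P_less)
    then show ?thesis
      using det_permute_rows[of "mat m m (\<lambda>(i, j). v j (f i))" m p] that
      by (simp add: d_def P_def)
  qed
  have bij: "bij_betw (\<lambda>f. f \<circ> p) F F" if "p \<in> P" for p
  proof -
    have p: "p permutes {0..<m}" using that by (simp add: P_def)
    \<comment> \<open>A permutation fixes the points outside \<open>{0..<m}\<close>, so the
      composition is still \<open>undefined\<close> there.\<close>
    have comp: "f \<circ> q \<in> F" if "f \<in> F" "q permutes {0..<m}" for f q
      using that permutes_in_image[OF that(2)] permutes_not_in[OF that(2)]
      by (fastforce simp: F_def PiE_iff extensional_def)
    show ?thesis
      by (rule bij_betw_byWitness[where f' = "\<lambda>f. f \<circ> Hilbert_Choice.inv p"])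
        (auto simp: comp[OF _ p] comp[OF _ permutes_inv[OF p]] o_assoc[symmetric]
          permutes_inv_o[OF p])
  qed
  \<comment> \<open>Each product of inner products is multiplied out over all coordinate choices
    \<open>f\<close>; the signed sum over \<open>p\<close> is then \<open>d f\<close> by
    \<open>d_row\<close>.\<close>
  have gram: "det (gram k m v) = (\<Sum>f\<in>F. (\<Prod>i=0..<m. v i (f i)) * d f)"
  proof -
    have "det (gram k m v) = (\<Sum>p\<in>P. signof p * (\<Prod>i=0..<m. \<Sum>c<k. v i c * v (p i) c))"
      unfolding gram_def ip_def
      by (subst det_def'[of _ m]) (auto intro!: sum.cong prod.cong simp: P_less simp flip: P_def)
    also have "\<dots> = (\<Sum>p\<in>P. signof p * (\<Sum>f\<in>F. (\<Prod>i=0..<m. v i (f i)) * (\<Prod>i=0..<m. v (p i) (f i))))"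
      by (simp add: F_def prod_sum_PiE prod.distrib)
    also have "\<dots> = (\<Sum>f\<in>F. \<Sum>p\<in>P. signof p * ((\<Prod>i=0..<m. v i (f i)) * (\<Prod>i=0..<m. v (p i) (f i))))"
      unfolding sum_distrib_left by (rule sum.swap)
    also have "\<dots> = (\<Sum>f\<in>F. (\<Prod>i=0..<m. v i (f i)) * d f)"
      by (simp add: d_row sum_distrib_left algebra_simps)
    finally show ?thesis .
  qed
  \<comment> \<open>Only one of the two factors \<open>d f\<close> is expanded; the sign goes into
    the other by \<open>d_comp\<close>. Substituting \<open>f\<close> for \<open>f o p\<close> then
    makes every permutation contribute the same Gram determinant, whence the factor
    \<open>fact m\<close>.\<close>
  have "(\<Sum>f\<in>F. (d f)\<^sup>2) = (\<Sum>f\<in>F. \<Sum>p\<in>P. (\<Prod>j=0..<m. v j ((f \<circ> p) j)) * (signof p * d f))"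
    unfolding power2_eq_square
    by (subst d_col) (simp add: sum_distrib_left sum_distrib_right algebra_simps)
  also have "\<dots> = (\<Sum>f\<in>F. \<Sum>p\<in>P. (\<Prod>j=0..<m. v j ((f \<circ> p) j)) * d (f \<circ> p))"
    by (intro sum.cong refl) (simp add: d_comp)
  also have "\<dots> = (\<Sum>p\<in>P. \<Sum>f\<in>F. (\<Prod>j=0..<m. v j ((f \<circ> p) j)) * d (f \<circ> p))"
    by (rule sum.swap)
  also have "\<dots> = (\<Sum>p\<in>P. \<Sum>f\<in>F. (\<Prod>j=0..<m. v j (f j)) * d f)"
    by (intro sum.cong refl sum.reindex_bij_betw[OF bij])
  also have "\<dots> = fact m * det (gram k m v)"
    by (simp add: gram P_def card_permutations[of _ m])
  finally show ?thesis
    by (simp add: F_def d_def)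
qed

text \<open>There are \<open>k ^ m\<close> coordinate choices in \<open>fact_mult_det_gram\<close>,
  each contributing at most \<open>b\<close> squared.\<close>

lemma det_gram_le:
  assumes "\<And>f. f \<in> {0..<m} \<rightarrow> {..<k} \<Longrightarrow> \<bar>det (mat m m (\<lambda>(i, j). v j (f i)))\<bar> \<le> b"
  shows "det (gram k m v) \<le> real k ^ m / fact m * b\<^sup>2"
proof -
  have "fact m * det (gram k m v) \<le> (\<Sum>f\<in>{0..<m} \<rightarrow>\<^sub>E {..<k}. b\<^sup>2)"
    unfolding fact_mult_det_gram
  proof (rule sum_mono)
    fix f assume "f \<in> {0..<m} \<rightarrow>\<^sub>E {..<k}"
    then have "\<bar>det (mat m m (\<lambda>(i, j). v j (f i)))\<bar> \<le> b"
      by (intro assms) auto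
    then show "(det (mat m m (\<lambda>(i, j). v j (f i))))\<^sup>2 \<le> b\<^sup>2"
      by (metis abs_ge_zero power2_abs power_mono)
  qed
  also have "\<dots> = real k ^ m * b\<^sup>2"
    by (simp add: card_PiE)
  finally show ?thesis
    by (simp add: field_simps)
qed

section \<open>The exponential estimate\<close>

lemma power_div_fact_le_exp:
  assumes "0 \<le> (x :: real)"
  shows "x ^ m / fact m \<le> exp x"
proof -
  have "(\<Sum>i\<in>{m}. x ^ i / fact i) \<le> (\<Sum>i. x ^ i / fact i)"
    using assms summable_exp[of x] by (intro sum_le_suminf) (auto simp: divide_inverse_commute)
  then show ?thesis
    by (simp add: exp_def divide_inverse_commute)
qed

text \<open>With t the number of classes, \<open>k ^ m\<close> is split as
  \<open>t ^ m * (k / t) ^ m\<close>. The exponents add up to \<open>k\<close>, and the t factors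
  \<open>exp (k / t)\<close> multiply to \<open>exp k\<close>, however the rows are
  distributed.\<close>

lemma prod_power_div_fact_le:
  fixes m :: "'c \<Rightarrow> nat"
  assumes "finite T" "T \<noteq> {}" "(\<Sum>a\<in>T. m a) = k"
  shows "(\<Prod>a\<in>T. real k ^ m a / fact (m a)) \<le> (exp 1 * real (card T)) ^ k"
proof -
  define t where "t = real (card T)"
  have t: "t > 0" using assms by (simp add: t_def card_gt_0_iff)
  have "(\<Prod>a\<in>T. real k ^ m a / fact (m a)) = (\<Prod>a\<in>T. t ^ m a * ((real k / t) ^ m a / fact (m a)))"
    using t by (intro prod.cong) (auto simp: power_divide)
  also have "\<dots> \<le> (\<Prod>a\<in>T. t ^ m a * exp (real k / t))"
    using t by (intro prod_mono conjI mult_left_mono power_div_fact_le_exp) auto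
  also have "\<dots> = t ^ k * exp (real k)"
    using t assms
    by (simp add: prod.distrib flip: power_sum exp_of_nat_mult t_def)
  also have "\<dots> = (exp 1 * t) ^ k"
    by (simp add: power_mult_distrib exp_of_nat_mult[symmetric] mult.commute)
  finally show ?thesis by (simp add: t_def)
qed

section \<open>Minors with arbitrary row and column choices\<close>

lemma detlb_nonneg: "0 \<le> detlb A"
proof (cases "dim_row A = 0 \<or> dim_col A = 0")
  case False
  then obtain x where "x \<in> detlb_values A"
    using detlb_values_nonempty by blast
  moreover from this have "0 \<le> x"
    by (auto simp: detlb_values_def)
  ultimately have "0 \<le> Max (detlb_values A)"
    using Max_ge[OF finite_detlb_values] by fastforce
  with False show ?thesis by (simp add: detlb_def)
qed (simp add: detlb_def)

text \<open>\<open>submatrix\<close> lists indices in increasing order; an injective choice in any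
  other order differs from it by a permutation of positions.\<close>

lemma permutes_pick_factor:
  assumes "inj_on s {..<m}"
  obtains p where "p permutes {..<m}" "\<And>i. i < m \<Longrightarrow> s i = pick (s ` {..<m}) (p i)"
proof -
  let ?S = "s ` {..<m}"
  have card: "card ?S = m" using assms by (simp add: card_image)
  have bij: "bij_betw (pick ?S) {..<m} ?S"
    using bij_betw_pick[of ?S] by (simp add: card)
  have "bij_betw (the_inv_into {..<m} (pick ?S) \<circ> s) {..<m} {..<m}"
    using assms bij_betw_the_inv_into[OF bij]
    by (intro bij_betw_trans[of s _ ?S]) (auto simp: bij_betw_def)
  then obtain p where p: "p permutes {..<m}"
    "\<And>i. i \<in> {..<m} \<Longrightarrow> p i = (the_inv_into {..<m} (pick ?S) \<circ> s) i"
  proof -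
    assume *: "\<And>p. p permutes {..<m} \<Longrightarrow>
      (\<And>i. i \<in> {..<m} \<Longrightarrow> p i = (the_inv_into {..<m} (pick ?S) \<circ> s) i) \<Longrightarrow> thesis"
    assume b: "bij_betw (the_inv_into {..<m} (pick ?S) \<circ> s) {..<m} {..<m}"
    \<comment> \<open>Extended by the identity, because \<open>permutes\<close> demands fixed points
      outside the set.\<close>
    let ?p = "\<lambda>i. if i \<in> {..<m} then (the_inv_into {..<m} (pick ?S) \<circ> s) i else i"
    have "bij_betw ?p {..<m} {..<m}"
      using b by (rule bij_betw_cong[THEN iffD1, rotated]) simp
    then have "?p permutes {..<m}"
      by (rule bij_imp_permutes) simp
    then show thesis by (rule *) simp
  qed
  have "s i = pick ?S (p i)" if "i < m" for i
    using that bij p(2)[of i] f_the_inv_into_f[of "pick ?S" "{..<m}" "s i"]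
    by (auto simp: bij_betw_def)
  with p(1) show thesis by (rule that)
qed

text \<open>A repeated row or column makes the determinant 0. Otherwise sorting the rows and the
  columns changes at most the sign and leads to a genuine submatrix.\<close>

lemma abs_det_le_detlb_power:
  assumes s: "s \<in> {..<m} \<rightarrow> {..<dim_row A}" and g: "g \<in> {..<m} \<rightarrow> {..<dim_col A}"
  shows "\<bar>det (mat m m (\<lambda>(i, j). A $$ (s i, g j)))\<bar> \<le> detlb A ^ m"
proof (cases "m = 0")
  \<comment> \<open>The empty determinant and the zeroth power are both 1.\<close>
  case True
  then show ?thesis by (simp add: det_dim_zero)
next
  case m: False
  let ?M = "mat m m (\<lambda>(i, j). A $$ (s i, g j))"
  consider "\<not> inj_on s {..<m}" | "\<not> inj_on g {..<m}" | "inj_on s {..<m}" "inj_on g {..<m}"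
    by blast
  then show ?thesis
  proof cases
    case 1
    then obtain i j where ij: "i < m" "j < m" "i \<noteq> j" "s i = s j"
      by (auto simp: inj_on_def)
    then have "row ?M i = row ?M j"
      by (intro eq_vecI) auto
    then have "det ?M = 0"
      using ij by (intro det_identical_rows[of _ m i j]) auto
    then show ?thesis by (simp add: detlb_nonneg)
  next
    case 2
    then obtain i j where ij: "i < m" "j < m" "i \<noteq> j" "g i = g j"
      by (auto simp: inj_on_def)
    then have "col ?M i = col ?M j"
      by (intro eq_vecI) auto
    then have "det ?M = 0"
      using ij by (intro det_identical_columns[of _ m i j]) auto
    then show ?thesis by (simp add: detlb_nonneg)
  next
    case 3
    let ?I = "s ` {..<m}" and ?J = "g ` {..<m}"
    have sub: "?I \<subseteq> {..<dim_row A}" "?J \<subseteq> {..<dim_col A}"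
      using s g by auto
    have card: "card ?I = m" "card ?J = m"
      using 3 by (auto simp: card_image)
    have "{i. i < dim_row A \<and> i \<in> ?I} = ?I" "{i. i < dim_col A \<and> i \<in> ?J} = ?J"
      using sub by auto
    then have S: "submatrix A ?I ?J = mat m m (\<lambda>(i, j). A $$ (pick ?I i, pick ?J j))"
      by (simp add: submatrix_def card)
    obtain p where p: "p permutes {..<m}" "\<And>i. i < m \<Longrightarrow> s i = pick ?I (p i)"
      using permutes_pick_factor[OF 3(1)] by blast
    obtain q where q: "q permutes {..<m}" "\<And>i. i < m \<Longrightarrow> g i = pick ?J (q i)"
      using permutes_pick_factor[OF 3(2)] by blast
    have p_less: "p i < m" and q_less: "q i < m" if "i < m" for i
      using that permutes_in_image[OF p(1), of i] permutes_in_image[OF q(1), of i] by auto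
    have abs_perm: "\<bar>det (mat m m (\<lambda>(i, j). B $$ (r i, j)))\<bar> = \<bar>det B\<bar>"
      if "B \<in> carrier_mat m m" "r permutes {..<m}" for B :: "real mat" and r
      using det_permute_rows[OF that(1)] that(2)
      by (simp add: atLeast0LessThan abs_mult sign_def)
    \<comment> \<open>Half-way matrix with sorted rows only. The columns are sorted after
      transposing, as \<open>abs_perm\<close> permutes rows.\<close>
    define N where "N = mat m m (\<lambda>(i, j). A $$ (pick ?I i, g j))"
    have "?M = mat m m (\<lambda>(i, j). N $$ (p i, j))"
      using p p_less by (intro eq_matI) (auto simp: N_def)
    then have "\<bar>det ?M\<bar> = \<bar>det N\<bar>"
      using abs_perm[of N p] p by (simp add: N_def)
    also have "\<dots> = \<bar>det (transpose_mat N)\<bar>"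
      by (subst det_transpose[of _ m]) (auto simp: N_def)
    also have "transpose_mat N = mat m m (\<lambda>(i, j). transpose_mat (submatrix A ?I ?J) $$ (q i, j))"
      unfolding S using q q_less by (intro eq_matI) (auto simp: N_def)
    also have "\<bar>det \<dots>\<bar> = \<bar>det (transpose_mat (submatrix A ?I ?J))\<bar>"
      using q S by (intro abs_perm) auto
    also have "\<dots> = \<bar>det (submatrix A ?I ?J)\<bar>"
      by (subst det_transpose[of _ m]) (auto simp: S)
    finally have eq: "\<bar>det ?M\<bar> = \<bar>det (submatrix A ?I ?J)\<bar>" .
    have "root m \<bar>det (submatrix A ?I ?J)\<bar> \<in> detlb_values A"
      unfolding detlb_values_def using sub card m by (intro CollectI exI[of _ m] exI) auto
    then have "root m \<bar>det ?M\<bar> \<le> Max (detlb_values A)"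
      unfolding eq by (intro Max_ge finite_detlb_values)
    \<comment> \<open>Since \<open>m\<close> is positive, \<open>s\<close> and \<open>g\<close> take
      values, so \<open>A\<close> has a row and a column and the default value 0 of
      \<open>detlb\<close> is excluded.\<close>
    also have "\<dots> = detlb A"
      using s g m by (auto simp: detlb_def)
    finally have "root m \<bar>det ?M\<bar> ^ m \<le> detlb A ^ m"
      using m by (intro power_mono) auto
    then show ?thesis using m by simp
  qed
qed

section \<open>Assembling the bound for one determinant and for \<open>detlb\<close>\<close>

text \<open>Row \<open>i\<close> is given by its origin, row \<open>s i\<close> of
  \<open>As (cl i)\<close>. Fischer's inequality splits the determinant along \<open>cl\<close>, and
  \<open>det_gram_le\<close> is applied to each class with \<open>b = D ^ m a\<close>. Classes may
  be empty and then contribute a factor 1.\<close>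

lemma abs_det_le_of_rows:
  fixes As :: "'c \<Rightarrow> real mat"
  assumes T: "finite T" "T \<noteq> {}"
    and cl: "\<And>i. i < k \<Longrightarrow> cl i \<in> T"
    and D: "\<And>a. a \<in> T \<Longrightarrow> detlb (As a) \<le> D"
    and s: "\<And>i. i < k \<Longrightarrow> s i < dim_row (As (cl i))"
    and g: "\<And>a j. a \<in> T \<Longrightarrow> j < k \<Longrightarrow> g j < dim_col (As a)"
  shows "\<bar>det (mat k k (\<lambda>(i, j). As (cl i) $$ (s i, g j)))\<bar> \<le> (D * sqrt (exp 1 * real (card T))) ^ k"
proof -
  define v where "v = (\<lambda>i j. As (cl i) $$ (s i, g j))"
  define S where "S = (\<lambda>a. {r. r < k \<and> cl r = a})"
  define m where "m = (\<lambda>a. card (S a))"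
  have D0: "0 \<le> D"
    using T D detlb_nonneg order_trans by blast
  have fin: "finite (S a)" for a by (simp add: S_def)
  have gram: "det (gram k (m a) (\<lambda>i. v (pick (S a) i))) \<le> real k ^ m a / fact (m a) * (D ^ m a)\<^sup>2"
    if a: "a \<in> T" for a
  proof (rule det_gram_le)
    fix f assume f: "f \<in> {0..<m a} \<rightarrow> {..<k}"
    have pick: "pick (S a) i < k" "cl (pick (S a) i) = a" if "i < m a" for i
      using pick_in_set_le[of i "S a"] that by (auto simp: m_def S_def)
    let ?N = "mat (m a) (m a) (\<lambda>(i, j). As a $$ (s (pick (S a) i), g (f j)))"
    \<comment> \<open>In \<open>det_gram_le\<close> the vectors form the columns, hence the
      transpose.\<close>
    have "mat (m a) (m a) (\<lambda>(i, j). v (pick (S a) j) (f i)) = transpose_mat ?N"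
      using pick by (intro eq_matI) (auto simp: v_def)
    then have "\<bar>det (mat (m a) (m a) (\<lambda>(i, j). v (pick (S a) j) (f i)))\<bar> = \<bar>det ?N\<bar>"
      using det_transpose[of ?N "m a"] by simp
    also have "\<dots> \<le> detlb (As a) ^ m a"
    proof (rule abs_det_le_detlb_power)
      show "(\<lambda>i. s (pick (S a) i)) \<in> {..<m a} \<rightarrow> {..<dim_row (As a)}"
        using s[OF pick(1)] pick(2) by (intro Pi_I) simp
      show "(\<lambda>j. g (f j)) \<in> {..<m a} \<rightarrow> {..<dim_col (As a)}"
        using f by (auto intro!: g[OF a] dest: funcset_mem)
    qed
    also have "\<dots> \<le> D ^ m a"
      using D[OF a] detlb_nonneg by (rule power_mono)
    finally show "\<bar>det (mat (m a) (m a) (\<lambda>(i, j). v (pick (S a) j) (f i)))\<bar> \<le> D ^ m a" .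
  qed
  \<comment> \<open>Nonnegative factors are required for multiplying the inequalities over the
    classes.\<close>
  have gram0: "0 \<le> det (gram k (m a) (\<lambda>i. v (pick (S a) i)))" for a
    using bij_betw_pick[OF fin, of a]
    by (simp add: det_gram_eq_prod_sqdist m_def bij_betw_def prod_nonneg sqdist_nonneg)
  have sum: "(\<Sum>a\<in>T. m a) = k"
  proof -
    have "(\<Sum>a\<in>T. \<Sum>i\<in>{i. i \<in> {..<k} \<and> cl i = a}. 1) = (\<Sum>i<k. 1 :: nat)"
      using cl by (intro sum.group T) auto
    then show ?thesis by (simp add: m_def S_def)
  qed
  have "(det (mat k k (\<lambda>(i, j). v i j)))\<^sup>2 \<le> (\<Prod>a\<in>T. det (gram k (m a) (\<lambda>i. v (pick (S a) i))))"
    using det_sq_le_prod_det_gram[of T cl k v] T cl by (auto simp: m_def S_def)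
  also have "\<dots> \<le> (\<Prod>a\<in>T. real k ^ m a / fact (m a) * (D ^ m a)\<^sup>2)"
    using gram gram0 by (intro prod_mono) auto
  also have "\<dots> = (\<Prod>a\<in>T. real k ^ m a / fact (m a)) * (D ^ k)\<^sup>2"
  proof -
    have "(\<Prod>a\<in>T. (D ^ m a)\<^sup>2) = (\<Prod>a\<in>T. D ^ m a)\<^sup>2"
      by (rule prod_power_distrib[symmetric])
    also have "\<dots> = (D ^ k)\<^sup>2"
      by (simp only: power_sum[symmetric] sum)
    finally show ?thesis
      by (simp only: prod.distrib)
  qed
  also have "\<dots> \<le> (exp 1 * real (card T)) ^ k * (D ^ k)\<^sup>2"
    by (intro mult_right_mono prod_power_div_fact_le T sum) simp
  \<comment> \<open>Writing the bound as a square allows the root to be taken by comparing absolute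
    values.\<close>
  also have "\<dots> = ((D * sqrt (exp 1 * real (card T))) ^ k)\<^sup>2"
    by (simp add: power_mult_distrib power_mult[symmetric] mult.commute[of k 2])
       (simp add: power_mult power_mult_distrib)
  finally have "\<bar>det (mat k k (\<lambda>(i, j). v i j))\<bar> \<le> \<bar>(D * sqrt (exp 1 * real (card T))) ^ k\<bar>"
    by (simp only: abs_le_square_iff)
  also have "\<dots> = (D * sqrt (exp 1 * real (card T))) ^ k"
    using D0 by (intro abs_of_nonneg zero_le_power mult_nonneg_nonneg) auto
  finally show ?thesis
    by (simp only: v_def)
qed

theorem lemma4:
  fixes t n :: nat and As :: "nat \<Rightarrow> real mat" and A :: "real mat" and D :: real
  assumes "t \<ge> 1"
    and "\<And>i. i \<in> {1..t} \<Longrightarrow> dim_col (As i) = n"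
    and "D = Max ((\<lambda>i. detlb (As i)) ` {1..t})"
    and "dim_col A = n"
    and "\<And>r. r < dim_row A \<Longrightarrow> \<exists>i\<in>{1..t}. \<exists>s<dim_row (As i). row A r = row (As i) s"
  shows "detlb A \<le> D * sqrt (exp 1 * real t)"
proof -
  have D: "detlb (As a) \<le> D" if "a \<in> {1..t}" for a
    unfolding assms(3) using that by (intro Max_ge) auto
  have "0 \<le> D"
    using D[of 1] detlb_nonneg[of "As 1"] assms(1) by simp
  then have bound_nonneg: "0 \<le> D * sqrt (exp 1 * real t)" by simp
  \<comment> \<open>A row may occur in several matrices; one origin is fixed for each.\<close>
  obtain cl s where cl: "\<And>r. r < dim_row A \<Longrightarrow>
      cl r \<in> {1..t} \<and> s r < dim_row (As (cl r)) \<and> row A r = row (As (cl r)) (s r)"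
    using assms(5) by metis
  have "x \<le> D * sqrt (exp 1 * real t)" if "x \<in> detlb_values A" for x
  proof -
    from that obtain k I J where k: "x = root k \<bar>det (submatrix A I J)\<bar>" "1 \<le> k"
      and I: "I \<subseteq> {..<dim_row A}" "card I = k" and J: "J \<subseteq> {..<dim_col A}" "card J = k"
      unfolding detlb_values_def by blast
    have pick: "pick I i < dim_row A" "pick J i < n" if "i < k" for i
      using pick_in_set_le[of i I] pick_in_set_le[of i J] that I J assms(4) by auto
    have "{i. i < dim_row A \<and> i \<in> I} = I" "{j. j < dim_col A \<and> j \<in> J} = J"
      using I J by auto
    then have "submatrix A I J = mat k k (\<lambda>(i, j). A $$ (pick I i, pick J j))"
      using I J by (simp add: submatrix_def)
    also have "\<dots> = mat k k (\<lambda>(i, j). As (cl (pick I i)) $$ (s (pick I i), pick J j))"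
    proof (rule cong_mat)
      fix i j assume ij: "i < k" "j < k"
      note c = cl[OF pick(1)[OF ij(1)]]
      have "A $$ (pick I i, pick J j) = row A (pick I i) $ pick J j"
        using pick ij assms(4) by simp
      also have "\<dots> = As (cl (pick I i)) $$ (s (pick I i), pick J j)"
        using c pick(2)[OF ij(2)] assms(2) by simp
      finally show "(case (i, j) of (i, j) \<Rightarrow> A $$ (pick I i, pick J j)) =
        (case (i, j) of (i, j) \<Rightarrow> As (cl (pick I i)) $$ (s (pick I i), pick J j))" by simp
    qed simp_all
    finally have "\<bar>det (submatrix A I J)\<bar> \<le> (D * sqrt (exp 1 * real (card {1..t}))) ^ k"
      using assms(1,2) cl pick D
      by (simp only:, intro abs_det_le_of_rows) auto
    then have "x \<le> root k ((D * sqrt (exp 1 * real t)) ^ k)"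
      using k by simp
    then show ?thesis
      using k bound_nonneg by (simp add: real_root_power_cancel)
  qed
  \<comment> \<open>If \<open>A\<close> has no rows or no columns, \<open>detlb A\<close> is 0 and
    \<open>bound_nonneg\<close> suffices.\<close>
  then show ?thesis
    using bound_nonneg detlb_values_nonempty[of A] finite_detlb_values[of A]
    by (simp add: detlb_def)
qed

end
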